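(* Let $F$ be a (nonzero) homogeneous form of degree $d$ in $n$ variables over $\mathbb{C}$, and let $\delta$ be the highest among the degrees of minimal generators of $F^\perp$. Then $d\le(\delta-1)n$.
   Context: Let $S=\mathbb{C}[x_1,\dots,x_n]$ and let $T=\mathbb{C}[\alpha_1,\dots,\alpha_n]$ act on $S$ by letting $\alpha_i$ act as $\partial/\partial x_i$; write $\Theta\circ F$ for this action. The apolar ideal of $F\in S$ is $F^\perp=\{\Theta\in T:\Theta\circ F=0\}$, a homogeneous ideal. With $\mathfrak m=\langle\alpha_1,\dots,\alpha_n\rangle$, a homogeneous ideal $I$ has a minimal generator of degree $k$ iff $(I/\mathfrak mI)_k\ne0$. *)

theory Defs
  imports Complex_Main "HOL-Library.Poly_Mapping" "HOL-Library.Cardinality"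
begin

text \<open>
  A finite type \<open>'n\<close> indexes the variables. The rings \<open>S\<close> and \<open>T\<close> are both represented by
  \<open>'n cpoly\<close>: exponent vectors are mapped to coefficients, and multiplication is convolution.
\<close>

type_synonym 'n cpoly = "('n \<Rightarrow>\<^sub>0 nat) \<Rightarrow>\<^sub>0 complex"

definition Var :: "'n \<Rightarrow> 'n cpoly" where
  "Var i = Poly_Mapping.single (Poly_Mapping.single i 1) 1"

definition Const :: "complex \<Rightarrow> 'n cpoly" where
  "Const c = Poly_Mapping.single 0 c"

definition mdeg :: "('n::finite \<Rightarrow>\<^sub>0 nat) \<Rightarrow> nat" where
  "mdeg m = (\<Sum>i\<in>UNIV. Poly_Mapping.lookup m i)"

definition homogeneous :: "nat \<Rightarrow> 'n::finite cpoly \<Rightarrow> bool" where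
  "homogeneous k F \<longleftrightarrow> (\<forall>m\<in>Poly_Mapping.keys F. mdeg m = k)"

text \<open>
  In \<open>pdiff\<close> the exponent subtraction is truncated, but a monomial that does not involve
  the variable \<open>i\<close> gets the coefficient \<open>0\<close>.
\<close>

definition pdiff :: "'n \<Rightarrow> 'n cpoly \<Rightarrow> 'n cpoly" where
  "pdiff i F = (\<Sum>m\<in>Poly_Mapping.keys F.
     Poly_Mapping.single (m - Poly_Mapping.single i 1)
       (of_nat (Poly_Mapping.lookup m i) * Poly_Mapping.lookup F m))"

text \<open>
  The fold composes the operators \<open>(pdiff i) ^^ (a i)\<close> over all variables \<open>i\<close>. It is
  well defined because partial derivatives commute (lemma \<open>pdiff_commute\<close>).
\<close>

definition pdiff_monom :: "('n::finite \<Rightarrow>\<^sub>0 nat) \<Rightarrow> 'n cpoly \<Rightarrow> 'n cpoly" where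
  "pdiff_monom a F = Finite_Set.fold (\<lambda>i. pdiff i ^^ Poly_Mapping.lookup a i) F UNIV"

definition diff_act :: "'n::finite cpoly \<Rightarrow> 'n cpoly \<Rightarrow> 'n cpoly" where
  "diff_act \<Theta> F =
     (\<Sum>a\<in>Poly_Mapping.keys \<Theta>. Const (Poly_Mapping.lookup \<Theta> a) * pdiff_monom a F)"

definition apolar_ideal :: "'n::finite cpoly \<Rightarrow> 'n cpoly set" where
  "apolar_ideal F = {\<Theta>. diff_act \<Theta> F = 0}"

text \<open>Ideals are the submodules of a commutative ring acting on itself by multiplication.\<close>

abbreviation ideal_span :: "'a::comm_ring_1 set \<Rightarrow> 'a set" where
  "ideal_span \<equiv> module.span (*)"

definition ideal_mult :: "'a::comm_ring_1 set \<Rightarrow> 'a set \<Rightarrow> 'a set" where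
  "ideal_mult I J = ideal_span {a * b |a b. a \<in> I \<and> b \<in> J}"

definition irrelevant_ideal :: "'n cpoly set" where
  "irrelevant_ideal = ideal_span (range Var)"

text \<open>
  For a homogeneous ideal \<open>I\<close>, the graded piece \<open>(I / \<mm> I)\<^sub>k\<close> is the image of \<open>I\<^sub>k\<close> in \<open>I / \<mm> I\<close>,
  so it is nonzero iff some form of degree \<open>k\<close> in \<open>I\<close> lies outside \<open>\<mm> I\<close>.
\<close>

definition min_gen_degrees :: "'n::finite cpoly set \<Rightarrow> nat set" where
  "min_gen_degrees I =
     {k. \<exists>\<Theta>\<in>I. homogeneous k \<Theta> \<and> \<Theta> \<notin> ideal_mult irrelevant_ideal I}"

lemma module_times: "module ((*) :: 'a::comm_ring_1 \<Rightarrow> 'a \<Rightarrow> 'a)"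
  by unfold_locales (simp_all add: algebra_simps)

lemma lookup_pdiff:
  "Poly_Mapping.lookup (pdiff i F) m =
     of_nat (Poly_Mapping.lookup m i + 1) * Poly_Mapping.lookup F (m + Poly_Mapping.single i 1)"
proof -
  let ?e = "Poly_Mapping.single i (1::nat)"
  let ?t = "\<lambda>p. of_nat (Poly_Mapping.lookup p i) * Poly_Mapping.lookup F p"
  have *: "Poly_Mapping.lookup (Poly_Mapping.single (p - ?e) (?t p)) m =
           (if p = m + ?e then ?t p else 0)" for p
  proof (cases "Poly_Mapping.lookup p i = 0")
    case True
    then have "p \<noteq> m + ?e" by (auto simp: lookup_add)
    then show ?thesis using True by simp
  next
    case False
    have "p - ?e + ?e = p"
      using False by (intro poly_mapping_eqI) (auto simp: lookup_add lookup_minus lookup_single when_def)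
    then have "p - ?e = m \<longleftrightarrow> p = m + ?e" by (metis add_diff_cancel_right')
    then show ?thesis by (auto simp: lookup_single when_def)
  qed
  have "Poly_Mapping.lookup (pdiff i F) m =
        (\<Sum>p\<in>Poly_Mapping.keys F. if p = m + ?e then ?t p else 0)"
    unfolding pdiff_def lookup_sum * ..
  also have "\<dots> = ?t (m + ?e)"
    by (subst sum.delta) (auto simp: in_keys_iff)
  finally show ?thesis by (simp add: lookup_add)
qed

lemma pdiff_commute: "pdiff i (pdiff j F) = pdiff j (pdiff i F)"
  by (cases "i = j") 
     (auto intro!: poly_mapping_eqI simp: lookup_pdiff lookup_add lookup_single when_def ac_simps)

lemma pdiff_monom_comp_fun_commute:
  "comp_fun_commute (\<lambda>i. pdiff i ^^ Poly_Mapping.lookup a i)"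
proof
  have 1: "(pdiff i ^^ k) (pdiff j F) = pdiff j ((pdiff i ^^ k) F)" for i j k and F :: "'a cpoly"
    by (induction k) (simp_all add: pdiff_commute)
  have "(pdiff i ^^ k) ((pdiff j ^^ l) F) = (pdiff j ^^ l) ((pdiff i ^^ k) F)"
    for i j k l and F :: "'a cpoly"
    by (induction l) (simp_all add: 1)
  then show "(pdiff y ^^ Poly_Mapping.lookup a y) \<circ> (pdiff x ^^ Poly_Mapping.lookup a x) =
        (pdiff x ^^ Poly_Mapping.lookup a x) \<circ> (pdiff y ^^ Poly_Mapping.lookup a y)" for x y
    by (simp add: fun_eq_iff)
qed

lemma diff_act_Var: "diff_act (Var i) F = pdiff i F"
proof -
  let ?a = "Poly_Mapping.single i (1::nat)"
  define f where "f = (\<lambda>j. pdiff j ^^ Poly_Mapping.lookup ?a j)"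
  interpret comp_fun_commute f
    unfolding f_def by (rule pdiff_monom_comp_fun_commute)
  have f: "f j = (if j = i then pdiff i else id)" for j
    by (simp add: f_def lookup_single when_def fun_eq_iff)
  have "Finite_Set.fold f F A = F" if "i \<notin> A" for A
    using finite[of A] that by (induction A rule: finite_induct) (auto simp: f)
  then have "pdiff_monom ?a F = pdiff i F"
    unfolding pdiff_monom_def f_def[symmetric] by (subst fold_rec[of UNIV i]) (auto simp: f)
  then show ?thesis
    by (simp add: diff_act_def Var_def Const_def)
qed

end

theory Submission
  imports Defs "HOL-Computational_Algebra.Fundamental_Theorem_Algebra" "HOL-Library.FuncSet"
begin

text \<open>
  Let \<open>J\<close> be the apolar ideal of \<open>F\<close>, let \<open>n\<close> be the number of variables, and let \<open>V\<close> be the space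
  of forms of degree \<open>\<delta>\<close> in \<open>J\<close>. By Macaulay duality, \<open>J\<close> is the largest ideal in the kernel of a
  linear functional that is supported in degree \<open>d\<close> (\<open>apolar_iff\<close>). So \<open>J\<close> contains every form of
  degree above \<open>d\<close> and misses some form of degree \<open>d\<close>. As \<open>J\<close> has no minimal generators in degrees
  above \<open>\<delta>\<close>, its part in degrees at least \<open>\<delta>\<close> lies in the ideal \<open>(V)\<close> (\<open>generated_in_degree\<close>). In
  particular \<open>(V)\<close> contains a power of each variable, that is, the forms in \<open>V\<close> have no common zero
  besides the origin.

  Over the infinite field of complex numbers, \<open>n\<close> general elements of such a space \<open>V\<close> form a
  regular sequence. They cut out a complete intersection, whose quotient ring vanishes in degrees
  above \<open>n(\<delta> - 1)\<close>. Hence every form of degree above \<open>n(\<delta> - 1)\<close> lies in \<open>(V)\<close>, which is contained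
  in \<open>J\<close> (\<open>forms_mem_if_primary\<close>). The form of degree \<open>d\<close> outside \<open>J\<close> then gives
  \<open>d \<le> n(\<delta> - 1)\<close>.

  The bound on complete intersections is obtained by exchanging the variables, from the last one to
  the first, for elements of \<open>V\<close>: the ideals in between are \<open>(x\<^sub>1, \<dots>, x\<^sub>r, f\<^sub>1, \<dots>, f\<^sub>j)\<close> with
  \<open>r + j = n\<close>. At each exchange, let \<open>K\<close> be the ideal of the elements that stay and \<open>x\<close> the variable
  that leaves. The quotient by \<open>K\<close> has dimension one and \<open>x\<close> is a nonzerodivisor on it. Three things
  are needed:

  \<^item> some \<open>f \<in> V\<close> is a parameter, in the sense that a power of \<open>x\<close> lies in \<open>K + (f)\<close>. Modulo \<open>K\<close>,
    each \<open>v \<in> V\<close> takes only finitely many values \<open>\<lambda>\<close> relative to \<open>x\<^sup>\<delta>\<close>, because \<open>K\<close> has a bounded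
    Hilbert function. So \<open>f\<close> only has to avoid finitely many linear conditions (\<open>exists_parameter\<close>);

  \<^item> the degree above which the ideal contains everything grows by at most \<open>\<delta> - 1\<close>
    (\<open>top_degree_parameter\<close>);

  \<^item> the variables that are left still form a regular sequence modulo the new forms
    (\<open>regular_sequence_replace\<close>).
\<close>

section \<open>Regular elements and radicals\<close>

interpretation ideal: module "(*) :: 'a::comm_ring_1 \<Rightarrow> 'a \<Rightarrow> 'a"
  by (rule module_times)

\<comment> \<open>For a ring acting on itself this rule is associativity read from right to left, so it would
  loop together with the usual normalisation of products.\<close>
declare ideal.scale_scale [simp del]

lemma mult_left_mem: "p \<in> ideal_span S \<Longrightarrow> r * p \<in> ideal_span S"
  by (rule ideal.span_scale)

lemma mult_right_mem: "p \<in> ideal_span S \<Longrightarrow> p * r \<in> ideal_span S"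
  by (subst mult.commute) (rule ideal.span_scale)

lemma mem_insert_iff: "p \<in> ideal_span (insert a S) \<longleftrightarrow> (\<exists>r. p - r * a \<in> ideal_span S)"
  by (simp add: ideal.span_insert)

lemma mem_mono: "p \<in> ideal_span S \<Longrightarrow> S \<subseteq> S' \<Longrightarrow> p \<in> ideal_span S'"
  using ideal.span_mono by blast

text \<open>
  A nonzerodivisor on the quotient by the ideal. The quotient by the larger ideal that also contains
  \<open>x\<close> is allowed to be zero.
\<close>

definition regular_mod :: "'a::comm_ring_1 set \<Rightarrow> 'a \<Rightarrow> bool" where
  "regular_mod S x \<longleftrightarrow> (\<forall>y. x * y \<in> ideal_span S \<longrightarrow> y \<in> ideal_span S)"

lemma regular_modD: "regular_mod S x \<Longrightarrow> x * y \<in> ideal_span S \<Longrightarrow> y \<in> ideal_span S"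
  unfolding regular_mod_def by blast

lemma regular_mod_power:
  assumes "regular_mod S x"
  shows "regular_mod S (x ^ n)"
proof (induction n)
  case (Suc n)
  have "y \<in> ideal_span S" if "x * (x ^ n * y) \<in> ideal_span S" for y
    using that by (blast intro: regular_modD[OF Suc] regular_modD[OF assms])
  then show ?case by (simp add: regular_mod_def mult.assoc)
qed (simp add: regular_mod_def)

text \<open>
  One half of the exchange law for regular sequences: if \<open>x, f\<close> is regular, then \<open>x\<close> stays regular
  modulo \<open>f\<close>. From a relation \<open>x y = r f\<close> one sees that \<open>x\<close> divides \<open>r\<close>, as \<open>f\<close> is regular modulo
  \<open>x\<close>, and then \<open>x\<close> cancels. The other half, that \<open>f\<close> itself is regular, requires a grading; it is
  \<open>regular_mod_descend\<close>.
\<close>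

lemma regular_mod_insert:
  assumes x: "regular_mod S x" and f: "regular_mod (insert x S) f"
  shows "regular_mod (insert f S) x"
  unfolding regular_mod_def
proof (intro allI impI)
  fix y assume "x * y \<in> ideal_span (insert f S)"
  then obtain r where r: "x * y - r * f \<in> ideal_span S"
    by (auto simp: mem_insert_iff)
  have "f * r - y * x \<in> ideal_span S"
    using ideal.span_neg[OF r] by (simp add: algebra_simps)
  then have "f * r \<in> ideal_span (insert x S)"
    by (auto simp: mem_insert_iff)
  then have "r \<in> ideal_span (insert x S)"
    by (rule regular_modD[OF f])
  then obtain q where q: "r - q * x \<in> ideal_span S"
    by (auto simp: mem_insert_iff)
  have "x * (y - q * f) = (x * y - r * f) + (r - q * x) * f"
    by (simp add: algebra_simps)
  also have "\<dots> \<in> ideal_span S"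
    by (intro ideal.span_add r mult_right_mem q)
  finally have "y - q * f \<in> ideal_span S"
    by (rule regular_modD[OF x])
  then show "y \<in> ideal_span (insert f S)"
    by (auto simp: mem_insert_iff)
qed

definition in_radical :: "'a::comm_ring_1 \<Rightarrow> 'a set \<Rightarrow> bool" where
  "in_radical z S \<longleftrightarrow> (\<exists>N. z ^ N \<in> ideal_span S)"

lemma in_radical_mono: "in_radical z S \<Longrightarrow> ideal_span S \<subseteq> ideal_span S' \<Longrightarrow> in_radical z S'"
  unfolding in_radical_def by blast

lemma in_radical_power_iff: "e > 0 \<Longrightarrow> in_radical (z ^ e) S \<longleftrightarrow> in_radical z S"
proof
  assume "e > 0" "in_radical z S"
  then obtain N where "z ^ N \<in> ideal_span S" by (auto simp: in_radical_def)
  moreover have "z ^ (e * N) = z ^ (e * N - N) * z ^ N"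
    using \<open>e > 0\<close> by (simp flip: power_add)
  ultimately have "(z ^ e) ^ N \<in> ideal_span S"
    by (simp add: mult_left_mem flip: power_mult)
  then show "in_radical (z ^ e) S" by (auto simp: in_radical_def)
qed (auto simp: in_radical_def simp flip: power_mult)

text \<open>
  An elementary substitute for prime avoidance: a prime ideal that contains a product contains one
  of the factors, so membership in a radical can be tested after adjoining either factor.
\<close>

lemma in_radical_if_product:
  assumes ab: "a * b \<in> ideal_span S"
    and "in_radical z (insert a S)" and "in_radical z (insert b S)"
  shows "in_radical z S"
proof -
  obtain N r where N: "z ^ N - r * a \<in> ideal_span S"
    using assms(2) by (auto simp: in_radical_def mem_insert_iff)
  obtain M q where M: "z ^ M - q * b \<in> ideal_span S"
    using assms(3) by (auto simp: in_radical_def mem_insert_iff)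
  have "z ^ (N + M) = (z ^ N - r * a) * z ^ M + r * a * (z ^ M - q * b) + r * q * (a * b)"
    by (simp add: algebra_simps power_add)
  also have "\<dots> \<in> ideal_span S"
    by (intro ideal.span_add mult_right_mem N mult_left_mem M ab)
  finally show ?thesis by (auto simp: in_radical_def)
qed

section \<open>Homogeneous components\<close>

lemma Const_0 [simp]: "Const 0 = 0" and Const_1 [simp]: "Const 1 = 1"
  by (simp_all add: Const_def)

lemma Const_add: "Const (a + b) = Const a + Const b"
  by (simp add: Const_def single_add)

lemma Const_mult: "Const (a * b) = Const a * Const b"
  by (simp add: Const_def mult_single)

lemma Const_uminus: "Const (- a) = - Const a"
  by (simp add: Const_def single_uminus)

lemma sum_single_keys:
  "(\<Sum>m\<in>Poly_Mapping.keys p. Poly_Mapping.single m (Poly_Mapping.lookup p m)) = p"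
  by (rule poly_mapping_eqI) (auto simp: lookup_sum lookup_single when_def in_keys_iff)

lemma lookup_single_mult:
  fixes p :: "'n cpoly"
  shows "Poly_Mapping.lookup (Poly_Mapping.single a c * p) (m + a) = c * Poly_Mapping.lookup p m"
proof -
  have "Poly_Mapping.single a c * p = (\<Sum>k\<in>Poly_Mapping.keys p.
      Poly_Mapping.single a c * Poly_Mapping.single k (Poly_Mapping.lookup p k))"
    by (simp only: sum_single_keys flip: sum_distrib_left)
  also have "\<dots> = (\<Sum>k\<in>Poly_Mapping.keys p.
      Poly_Mapping.single (k + a) (c * Poly_Mapping.lookup p k))"
    by (simp add: mult_single add.commute)
  finally show ?thesis
    by (auto simp: lookup_sum lookup_single when_def in_keys_iff)
qed

lemma lookup_Const_mult: "Poly_Mapping.lookup (Const c * p) m = c * Poly_Mapping.lookup p m"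
  using lookup_single_mult[of 0 c p m] by (simp add: Const_def)

lemma mdeg_add: "mdeg (a + b) = mdeg a + mdeg b"
  by (simp add: mdeg_def lookup_add sum.distrib)

lemma mdeg_0 [simp]: "mdeg 0 = 0"
  by (simp add: mdeg_def)

lemma mdeg_single [simp]: "mdeg (Poly_Mapping.single i k) = k"
  by (simp add: mdeg_def lookup_single when_def)

lemma finite_mdeg: "finite {m :: 'n::finite \<Rightarrow>\<^sub>0 nat. mdeg m = s}"
proof (rule finite_imageD)
  have "Poly_Mapping.lookup m i \<le> mdeg m" for m :: "'n \<Rightarrow>\<^sub>0 nat" and i
    unfolding mdeg_def by (rule member_le_sum) auto
  then have "Poly_Mapping.lookup ` {m :: 'n \<Rightarrow>\<^sub>0 nat. mdeg m = s} \<subseteq> (UNIV \<rightarrow>\<^sub>E {..s})"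
    by auto
  then show "finite (Poly_Mapping.lookup ` {m :: 'n \<Rightarrow>\<^sub>0 nat. mdeg m = s})"
    by (rule finite_subset) (simp add: finite_PiE)
  show "inj_on Poly_Mapping.lookup {m :: 'n \<Rightarrow>\<^sub>0 nat. mdeg m = s}"
    by (simp add: inj_on_def)
qed

lemma homogeneous_0 [simp]: "homogeneous k 0"
  by (simp add: homogeneous_def)

lemma homogeneous_single: "mdeg m = k \<Longrightarrow> homogeneous k (Poly_Mapping.single m c)"
  by (simp add: homogeneous_def)

lemma homogeneous_Var: "homogeneous 1 (Var i)"
  by (simp add: Var_def homogeneous_single)

lemma homogeneous_Const: "homogeneous 0 (Const c)"
  by (simp add: Const_def homogeneous_single)

lemma homogeneous_add: "homogeneous k p \<Longrightarrow> homogeneous k q \<Longrightarrow> homogeneous k (p + q)"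
  using Poly_Mapping.keys_add[of p q] by (auto simp: homogeneous_def)

lemma homogeneous_mult: "homogeneous k p \<Longrightarrow> homogeneous l q \<Longrightarrow> homogeneous (k + l) (p * q)"
  using keys_mult[of p q] by (fastforce simp: homogeneous_def mdeg_add)

lemma homogeneous_power: "homogeneous k p \<Longrightarrow> homogeneous (n * k) (p ^ n)"
  using homogeneous_Const[of 1] by (induction n) (auto intro: homogeneous_mult)

lemma homogeneous_0_eq_Const:
  fixes p :: "'n::finite cpoly"
  assumes "homogeneous 0 p"
  shows "\<exists>c. p = Const c"
proof
  have "m = 0" if "m \<in> Poly_Mapping.keys p" for m
    using assms that by (intro poly_mapping_eqI) (auto simp: homogeneous_def mdeg_def)
  then show "p = Const (Poly_Mapping.lookup p 0)"
    unfolding Const_def by (intro poly_mapping_eqI) (auto simp: lookup_single when_def in_keys_iff)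
qed

definition hcomp :: "nat \<Rightarrow> 'n::finite cpoly \<Rightarrow> 'n cpoly" where
  "hcomp k p = Poly_Mapping.mapp (\<lambda>m c. if mdeg m = k then c else 0) p"

lemma lookup_hcomp:
  "Poly_Mapping.lookup (hcomp k p) m = (if mdeg m = k then Poly_Mapping.lookup p m else 0)"
  by (auto simp: hcomp_def lookup_mapp when_def in_keys_iff)

lemma homogeneous_hcomp: "homogeneous k (hcomp k p)"
  by (auto simp: homogeneous_def in_keys_iff lookup_hcomp split: if_splits)

lemma hcomp_homogeneous: "homogeneous l p \<Longrightarrow> hcomp k p = (if k = l then p else 0)"
  by (rule poly_mapping_eqI) (auto simp: homogeneous_def in_keys_iff lookup_hcomp)

lemma hcomp_0 [simp]: "hcomp k 0 = 0"
  by (rule poly_mapping_eqI) (simp add: lookup_hcomp)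

lemma hcomp_add: "hcomp k (p + q) = hcomp k p + hcomp k q"
  by (rule poly_mapping_eqI) (simp add: lookup_hcomp lookup_add)

lemma hcomp_diff: "hcomp k (p - q) = hcomp k p - hcomp k q"
  by (rule poly_mapping_eqI) (simp add: lookup_hcomp lookup_minus)

lemma hcomp_sum: "hcomp k (sum f A) = (\<Sum>a\<in>A. hcomp k (f a))"
  by (induction A rule: infinite_finite_induct) (simp_all add: hcomp_add)

lemma sum_hcomp: "p = (\<Sum>k\<in>mdeg ` Poly_Mapping.keys p. hcomp k p)"
  by (rule poly_mapping_eqI) (auto simp: lookup_sum lookup_hcomp in_keys_iff)

lemma hcomp_mult:
  assumes "homogeneous e q"
  shows "hcomp k (p * q) = (if e \<le> k then hcomp (k - e) p * q else 0)"
proof -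
  let ?L = "mdeg ` Poly_Mapping.keys p"
  have "p * q = (\<Sum>l\<in>?L. hcomp l p * q)"
    by (subst sum_hcomp[of p]) (simp add: sum_distrib_right)
  then have "hcomp k (p * q) = (\<Sum>l\<in>?L. hcomp k (hcomp l p * q))"
    by (simp add: hcomp_sum)
  also have "\<dots> = (\<Sum>l\<in>?L. if k = l + e then hcomp l p * q else 0)"
    by (intro sum.cong refl hcomp_homogeneous homogeneous_mult homogeneous_hcomp assms)
  also have "\<dots> = (\<Sum>l\<in>?L. if e \<le> k \<and> l = k - e then hcomp (k - e) p * q else 0)"
    by (intro sum.cong refl) auto
  also have "\<dots> = (if e \<le> k then hcomp (k - e) p * q else 0)"
  proof (cases "k - e \<in> ?L")
    case False
    then have "hcomp (k - e) p = 0"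
      by (intro poly_mapping_eqI) (force simp: lookup_hcomp in_keys_iff image_iff)
    then show ?thesis by (auto intro: sum.neutral)
  qed auto
  finally show ?thesis .
qed

text \<open>The forms of all degrees; a set of generators inside \<open>forms\<close> spans a homogeneous ideal.\<close>

definition forms :: "'n::finite cpoly set" where
  "forms = {p. \<exists>e. homogeneous e p}"

lemma formsI: "homogeneous e p \<Longrightarrow> p \<in> forms"
  by (auto simp: forms_def)

lemma hcomp_mem:
  assumes "S \<subseteq> forms" and "p \<in> ideal_span S"
  shows "hcomp k p \<in> ideal_span S"
  using assms(2)
proof (induction p rule: ideal.span_induct_alt)
  case base
  show ?case by (simp add: ideal.span_zero)
next
  case (step c x y)
  obtain e where "homogeneous e x" using step(1) assms(1) by (auto simp: forms_def)
  then show ?case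
    using step
    by (auto simp: hcomp_add hcomp_mult intro: ideal.span_add mult_left_mem[OF ideal.span_base])
qed

lemma mem_if_hcomp_mem:
  assumes "\<And>k. hcomp k p \<in> ideal_span S"
  shows "p \<in> ideal_span S"
  by (subst sum_hcomp) (intro ideal.span_sum assms)

text \<open>
  In a homogeneous ideal the cofactor of a homogeneous generator can be chosen homogeneous of the
  complementary degree; if that degree would be negative, the generator does not contribute.
\<close>

lemma form_mem_insert:
  assumes S: "S \<subseteq> forms" and a: "homogeneous e a" and p: "homogeneous k p"
    and "p \<in> ideal_span (insert a S)"
  shows "p \<in> ideal_span S \<or> (e \<le> k \<and> (\<exists>r. homogeneous (k - e) r \<and> p - r * a \<in> ideal_span S))"
proof -
  obtain r where "p - r * a \<in> ideal_span S"
    using assms(4) by (auto simp: mem_insert_iff)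
  from hcomp_mem[OF S this, of k]
  have "p - hcomp k (r * a) \<in> ideal_span S"
    using p by (simp add: hcomp_diff hcomp_homogeneous)
  then show ?thesis
    using homogeneous_hcomp by (auto simp: hcomp_mult[OF a] split: if_splits)
qed

text \<open>
  The graded half of the exchange law. An element \<open>y\<close> that \<open>f\<close> annihilates is divisible by \<open>x\<close>,
  because \<open>f\<close> is regular modulo \<open>x\<close>; the quotient is again annihilated by \<open>f\<close>, as \<open>x\<close> is regular,
  and has smaller degree. So the annihilator of \<open>f\<close> vanishes by induction on the degree.
\<close>

lemma regular_mod_descend:
  assumes S: "S \<subseteq> forms" and xh: "homogeneous e x" "e > 0" and fh: "homogeneous l f"
    and x: "regular_mod S x" and f: "regular_mod (insert x S) f"
  shows "regular_mod S f"
proof -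
  have hom: "y \<in> ideal_span S" if "homogeneous k y" "f * y \<in> ideal_span S" for k y
    using that
  proof (induction k arbitrary: y rule: less_induct)
    case (less k)
    have "y \<in> ideal_span (insert x S)"
      by (rule regular_modD[OF f]) (rule mem_mono[OF less.prems(2)], auto)
    from form_mem_insert[OF S xh(1) less.prems(1) this]
    consider "y \<in> ideal_span S" 
      | r where "e \<le> k" "homogeneous (k - e) r" "y - r * x \<in> ideal_span S"
      by blast
    then show ?case
    proof cases
      case 2
      have "x * (f * r) = f * y - f * (y - r * x)"
        by (simp add: algebra_simps)
      also have "\<dots> \<in> ideal_span S"
        by (intro ideal.span_diff less.prems(2) mult_left_mem 2)
      finally have "f * r \<in> ideal_span S"
        by (rule regular_modD[OF x])
      then have "r \<in> ideal_span S"
        using 2 xh(2) by - (rule less.IH[of "k - e"], auto)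
      then have "(y - r * x) + r * x \<in> ideal_span S"
        by (intro ideal.span_add 2 mult_right_mem)
      then show ?thesis by simp
    qed
  qed
  show ?thesis unfolding regular_mod_def
  proof (intro allI impI)
    fix y assume y: "f * y \<in> ideal_span S"
    have "f * hcomp k y \<in> ideal_span S" for k
      using hcomp_mem[OF S y, of "k + l"] hcomp_mult[OF fh, of "k + l" y]
      by (simp add: mult.commute)
    then have "hcomp k y \<in> ideal_span S" for k
      by (rule hom[OF homogeneous_hcomp])
    then show "y \<in> ideal_span S"
      by (rule mem_if_hcomp_mem)
  qed
qed

section \<open>Ideals generated by variables\<close>

lemma mem_Vars_if_keys:
  assumes "\<And>m. m \<in> Poly_Mapping.keys p \<Longrightarrow> \<exists>i\<in>I. Poly_Mapping.lookup m i \<noteq> 0"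
  shows "p \<in> ideal_span (Var ` I)"
proof -
  have "p = (\<Sum>m\<in>Poly_Mapping.keys p. Poly_Mapping.single m (Poly_Mapping.lookup p m))"
    by (simp add: sum_single_keys)
  also have "\<dots> \<in> ideal_span (Var ` I)"
  proof (intro ideal.span_sum)
    fix m assume "m \<in> Poly_Mapping.keys p"
    then obtain i where i: "i \<in> I" "Poly_Mapping.lookup m i \<noteq> 0"
      using assms by blast
    have "m = m - Poly_Mapping.single i 1 + Poly_Mapping.single i 1"
      using i(2) by (intro poly_mapping_eqI) (auto simp: lookup_add lookup_minus lookup_single when_def)
    then have "Poly_Mapping.single m (Poly_Mapping.lookup p m)
      = Poly_Mapping.single (m - Poly_Mapping.single i 1) (Poly_Mapping.lookup p m) * Var i"
      by (simp add: Var_def mult_single)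
    then show "Poly_Mapping.single m (Poly_Mapping.lookup p m) \<in> ideal_span (Var ` I)"
      using i(1) by (simp add: mult_left_mem ideal.span_base)
  qed
  finally show ?thesis .
qed

lemma lookup_Var_mult:
  "Poly_Mapping.lookup (Var i * p) (m + Poly_Mapping.single i 1) = Poly_Mapping.lookup p m"
  by (simp add: Var_def lookup_single_mult)

lemma keys_if_mem_Vars:
  assumes "p \<in> ideal_span (Var ` I)" and "m \<in> Poly_Mapping.keys p"
  shows "\<exists>i\<in>I. Poly_Mapping.lookup m i \<noteq> 0"
  using assms
proof (induction p arbitrary: m rule: ideal.span_induct_alt)
  case (step c x y)
  from step(1) obtain i where i: "i \<in> I" "x = Var i" by auto
  consider "m \<in> Poly_Mapping.keys (c * x)" | "m \<in> Poly_Mapping.keys y"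
    using step.prems Poly_Mapping.keys_add[of "c * x" y] by blast
  then show ?case
  proof cases
    case 1
    then obtain a where "m = a + Poly_Mapping.single i 1"
      using keys_mult[of c x] by (auto simp: i Var_def)
    then show ?thesis using i(1) by (auto simp: lookup_add intro!: bexI[of _ i])
  qed (use step in auto)
qed simp

lemma regular_mod_Vars:
  assumes "i \<notin> I"
  shows "regular_mod (Var ` I) (Var i)"
  unfolding regular_mod_def
proof (intro allI impI mem_Vars_if_keys)
  fix y m assume y: "Var i * y \<in> ideal_span (Var ` I)" and "m \<in> Poly_Mapping.keys y"
  then have "m + Poly_Mapping.single i 1 \<in> Poly_Mapping.keys (Var i * y)"
    by (simp only: in_keys_iff lookup_Var_mult not_False_eq_True)
  from keys_if_mem_Vars[OF y this] show "\<exists>j\<in>I. Poly_Mapping.lookup m j \<noteq> 0"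
    using assms by (force simp: lookup_add lookup_single when_def split: if_splits)
qed

lemma form_mem_all_Vars:
  assumes "homogeneous k p" and "k > 0"
  shows "p \<in> ideal_span (range Var)"
proof (rule mem_Vars_if_keys)
  fix m assume "m \<in> Poly_Mapping.keys p"
  then have "mdeg m \<noteq> 0" using assms by (auto simp: homogeneous_def)
  then show "\<exists>i\<in>UNIV. Poly_Mapping.lookup m i \<noteq> 0" by (auto simp: mdeg_def)
qed

section \<open>Parameters in a space of forms of equal degree\<close>

lemma linear_dependence:
  fixes w :: "nat \<Rightarrow> 'n cpoly"
  assumes B: "finite B" "card B \<le> e"
    and w: "\<And>i. i \<le> e \<Longrightarrow> Poly_Mapping.keys (w i) \<subseteq> B"
  obtains c :: "nat \<Rightarrow> complex" 
    where "\<exists>i\<le>e. c i \<noteq> 0" "(\<Sum>i\<le>e. Const (c i) * w i) = 0"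
proof (cases "inj_on w {..e}")
  case False
  then obtain i j where ij: "i \<le> e" "j \<le> e" "i \<noteq> j" "w i = w j"
    by (auto simp: inj_on_def)
  define c :: "nat \<Rightarrow> complex" where "c k = (if k = i then 1 else if k = j then - 1 else 0)" for k
  have "(\<Sum>k\<le>e. Const (c k) * w k)
      = (\<Sum>k\<le>e. (if k = i then w i else 0) - (if k = j then w j else 0))"
    using ij by (intro sum.cong refl) (auto simp: c_def Const_uminus)
  also have "\<dots> = 0"
    using ij by (simp add: sum_subtractf)
  finally show thesis
    using ij by (intro that[of c]) (auto simp: c_def)
next
  case True
  interpret V: vector_space "\<lambda>c (p :: 'n cpoly). Const c * p"
    by unfold_locales (simp_all add: algebra_simps Const_add Const_mult)
  define T :: "'n cpoly set" where "T = (\<lambda>m. Poly_Mapping.single m 1) ` B"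
  have "w i \<in> V.span T" if "i \<le> e" for i
  proof -
    have "w i = (\<Sum>m\<in>Poly_Mapping.keys (w i).
        Const (Poly_Mapping.lookup (w i) m) * Poly_Mapping.single m 1)"
      by (simp add: Const_def mult_single sum_single_keys)
    also have "\<dots> \<in> V.span T"
      using w[OF that] by (intro V.span_sum V.span_scale V.span_base) (auto simp: T_def)
    finally show ?thesis .
  qed
  then have sub: "w ` {..e} \<subseteq> V.span T" by auto
  have "V.dependent (w ` {..e})"
  proof (rule ccontr)
    assume "V.independent (w ` {..e})"
    from V.independent_span_bound[OF _ this sub]
    have "card (w ` {..e}) \<le> card T" using B(1) by (simp add: T_def)
    also have "\<dots> \<le> e" using card_image_le[OF B(1)] B(2) by (auto simp: T_def intro: order.trans)
    finally show False using card_image[OF True] by simp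
  qed
  then obtain u where u: "\<exists>v\<in>w ` {..e}. u v \<noteq> 0" "(\<Sum>v\<in>w ` {..e}. Const (u v) * v) = 0"
    by (subst (asm) V.dependent_finite) auto
  then show thesis
    by (intro that[of "\<lambda>i. u (w i)"]) (auto simp: sum.reindex[OF True])
qed

text \<open>
  The value at \<open>(v, z)\<close> of the homogenisation of \<open>p\<close> to degree \<open>D\<close>; it is the binary form
  \<open>z\<^sup>D p(v / z)\<close> when \<open>D\<close> is at least the degree of \<open>p\<close>.
\<close>

definition homog_eval :: "complex poly \<Rightarrow> 'n cpoly \<Rightarrow> 'n cpoly \<Rightarrow> nat \<Rightarrow> 'n cpoly" where
  "homog_eval p v z D = (\<Sum>i\<le>D. Const (coeff p i) * v ^ i * z ^ (D - i))"

lemma homog_eval_linear_factor: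
  assumes "degree q \<le> D"
  shows "homog_eval ([:- l, 1:] * q) v z (Suc D) = (v - Const l * z) * homog_eval q v z D"
proof -
  have 0: "coeff q (Suc D) = 0" using assms by (intro coeff_eq_0) simp
  have 1: "homog_eval (pCons 0 q) v z (Suc D) = v * homog_eval q v z D"
    unfolding homog_eval_def 
    by (subst sum.atMost_Suc_shift) (simp add: sum_distrib_left algebra_simps)
  have 2: "homog_eval q v z (Suc D) = z * homog_eval q v z D"
    by (simp add: homog_eval_def 0 sum_distrib_left algebra_simps Suc_diff_le)
  have coeff: "Const (coeff ([:- l, 1:] * q) i) 
      = Const (coeff (pCons 0 q) i) - Const l * Const (coeff q i)" for i
    using Const_add[of "coeff (pCons 0 q) i" "- (l * coeff q i)"]
    by (simp add: Const_uminus Const_mult)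
  have "homog_eval ([:- l, 1:] * q) v z (Suc D)
      = homog_eval (pCons 0 q) v z (Suc D) - Const l * homog_eval q v z (Suc D)"
    unfolding homog_eval_def coeff
    by (simp only: left_diff_distrib sum_subtractf sum_distrib_left mult.assoc)
  then show ?thesis by (simp add: 1 2 algebra_simps)
qed

text \<open>
  Over the complex numbers a binary form in \<open>v\<close> and \<open>z\<close> is a product of linear factors \<open>v - l z\<close> and
  powers of \<open>z\<close>. If it vanishes modulo an ideal, then to find a power of \<open>z\<close> in the ideal one may set
  \<open>v = l z\<close> for one root \<open>l\<close> at a time. At a factor \<open>z\<close>, the ideal with \<open>z\<close> adjoined
  contains \<open>z\<close> itself. The set of roots depends on the form only, and not on the ideal.
\<close>

lemma in_radical_if_linear_factors:
  fixes p :: "complex poly" and v z :: "'n cpoly"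
  assumes "p \<noteq> 0" and "degree p \<le> D"
  shows "\<exists>L. finite L \<and> (\<forall>S. homog_eval p v z D \<in> ideal_span S \<longrightarrow>
           (\<forall>l\<in>L. in_radical z (insert (v - Const l * z) S)) \<longrightarrow> in_radical z S)"
  using assms
proof (induction "degree p" arbitrary: p D)
  case 0
  then obtain a where a: "p = [:a:]" "a \<noteq> 0" by (metis degree_eq_zeroE pCons_0_0)
  have "homog_eval p v z D = (\<Sum>i\<le>D. if i = 0 then Const a * z ^ D else 0)"
    unfolding homog_eval_def a by (intro sum.cong refl) (auto simp: coeff_pCons split: nat.splits)
  also have "\<dots> = Const a * z ^ D" by simp
  finally have "z ^ D = Const (1 / a) * homog_eval p v z D"
    using a(2) by (simp add: mult.assoc[symmetric] flip: Const_mult)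
  then have "z ^ D \<in> ideal_span S" if "homog_eval p v z D \<in> ideal_span S" for S
    using that by (metis mult_left_mem)
  then show ?case by (intro exI[of _ "{}"]) (auto simp: in_radical_def)
next
  case (Suc n)
  have "\<not> constant (poly p)" using Suc.hyps(2) by (simp add: constant_degree)
  then obtain l where "poly p l = 0" using fundamental_theorem_of_algebra by blast
  then obtain q where q: "p = [:- l, 1:] * q" by (auto simp: poly_eq_0_iff_dvd)
  have "q \<noteq> 0" using Suc.prems(1) q by auto
  then have deg: "degree p = Suc (degree q)"
    by (subst q, subst degree_mult_eq) auto
  then obtain D' where D: "D = Suc D'" "degree q \<le> D'"
    using Suc.prems(2) by (cases D) auto
  obtain L where L: "finite L" "\<And>S. homog_eval q v z D' \<in> ideal_span S \<Longrightarrow>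
      (\<forall>l\<in>L. in_radical z (insert (v - Const l * z) S)) \<Longrightarrow> in_radical z S"
    using Suc.hyps(1)[of q D'] Suc.hyps(2) deg D(2) \<open>q \<noteq> 0\<close> by auto
  show ?case
  proof (intro exI[of _ "insert l L"] conjI allI impI)
    fix S assume ev: "homog_eval p v z D \<in> ideal_span S"
      and rad: "\<forall>l\<in>insert l L. in_radical z (insert (v - Const l * z) S)"
    show "in_radical z S"
    proof (rule in_radical_if_product)
      show "(v - Const l * z) * homog_eval q v z D' \<in> ideal_span S"
        using ev by (simp only: q D homog_eval_linear_factor)
      show "in_radical z (insert (v - Const l * z) S)" using rad by simp
      show "in_radical z (insert (homog_eval q v z D') S)"
      proof (rule L(2))
        show "\<forall>l\<in>L. in_radical z (insert (v - Const l * z) (insert (homog_eval q v z D') S))"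
        proof
          fix l assume "l \<in> L"
          then have "in_radical z (insert (v - Const l * z) S)" using rad by simp
          then show "in_radical z (insert (v - Const l * z) (insert (homog_eval q v z D') S))"
            by (rule in_radical_mono) (intro ideal.span_mono, auto)
        qed
      qed (simp add: ideal.span_base)
    qed
  qed (use L(1) in simp)
qed

text \<open>The quotient ring by the ideal vanishes in all degrees above \<open>s\<close>.\<close>

definition all_forms_above :: "nat \<Rightarrow> 'n::finite cpoly set \<Rightarrow> bool" where
  "all_forms_above s S \<longleftrightarrow> (\<forall>k>s. \<forall>u. homogeneous k u \<longrightarrow> u \<in> ideal_span S)"

lemma all_forms_aboveD: "all_forms_above s S \<Longrightarrow> k > s \<Longrightarrow> homogeneous k u \<Longrightarrow> u \<in> ideal_span S"
  by (simp add: all_forms_above_def)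

text \<open>
  If the quotient by \<open>x\<close> and \<open>S\<close> vanishes above degree \<open>s\<close>, then multiplication by \<open>x\<close> is surjective
  on the quotient by \<open>S\<close> from degree \<open>s\<close> on, so every form of higher degree comes from degree \<open>s\<close>.
\<close>

lemma form_reduce:
  assumes S: "S \<subseteq> forms" and x: "homogeneous 1 x"
    and top: "all_forms_above s (insert x S)"
    and k: "s \<le> k" and u: "homogeneous k u"
  shows "\<exists>r. homogeneous s r \<and> u - r * x ^ (k - s) \<in> ideal_span S"
  using k u
proof (induction k arbitrary: u rule: dec_induct)
  case base
  then show ?case by (intro exI[of _ u]) (simp add: ideal.span_zero)
next
  case (step k)
  have "u \<in> ideal_span (insert x S)" using step by (intro all_forms_aboveD[OF top, of "Suc k"]) auto
  from form_mem_insert[OF S x step.prems this]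
  consider "u \<in> ideal_span S" | u' where "homogeneous k u'" "u - u' * x \<in> ideal_span S"
    by auto
  then show ?case
  proof cases
    case 1
    then show ?thesis by (intro exI[of _ 0]) simp
  next
    case 2
    obtain r where r: "homogeneous s r" "u' - r * x ^ (k - s) \<in> ideal_span S"
      using step.IH[OF 2(1)] by blast
    have "u - r * x ^ (Suc k - s) = (u - u' * x) + (u' - r * x ^ (k - s)) * x"
      using step.hyps by (simp add: Suc_diff_le algebra_simps)
    also have "\<dots> \<in> ideal_span S"
      by (intro ideal.span_add 2 mult_right_mem r)
    finally show ?thesis using r(1) by blast
  qed
qed

text \<open>
  Geometrically, the ideal \<open>(S)\<close> defines finitely many points off the hyperplane \<open>x = 0\<close>, and \<open>L\<close>
  contains the values of \<open>v / x\<^sup>\<delta>\<close> at these points. Such a finite set exists by a dimension count.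
  Modulo \<open>S\<close>, all products \<open>v\<^sup>i x\<^sup>\<delta>\<^sup>(\<^sup>e\<^sup>-\<^sup>i\<^sup>)\<close> with \<open>i \<le> e\<close> come from the space of forms of degree \<open>s\<close>
  (\<open>form_reduce\<close>). If \<open>e\<close> is at least the dimension of this space, they are linearly dependent, and
  the relation is a binary form in \<open>v\<close> and \<open>x\<^sup>\<delta>\<close> that vanishes modulo \<open>S\<close>.
\<close>

lemma finite_eigenvalues:
  fixes x v :: "'n::finite cpoly"
  assumes S: "S \<subseteq> forms" and x: "homogeneous 1 x"
    and top: "all_forms_above s (insert x S)"
    and v: "homogeneous \<delta> v" and "\<delta> > 0"
  obtains L where "finite L"
    and "\<And>S'. S \<subseteq> S' \<Longrightarrow> (\<And>l. l \<in> L \<Longrightarrow> in_radical x (insert (v - Const l * x ^ \<delta>) S'))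
           \<Longrightarrow> in_radical x S'"
proof -
  define B :: "('n \<Rightarrow>\<^sub>0 nat) set" where "B = {m. mdeg m = s}"
  \<comment> \<open>The summand \<open>card B\<close> forces the linear dependence; the summand \<open>s\<close> makes the common degree
    \<open>e * \<delta>\<close> of the products at least \<open>s\<close>.\<close>
  define e where "e = card B + s"
  have "s \<le> e * \<delta>" using \<open>\<delta> > 0\<close> by (simp add: e_def algebra_simps trans_le_add1)
  have "\<exists>r. homogeneous s r \<and> v ^ i * (x ^ \<delta>) ^ (e - i) - r * x ^ (e * \<delta> - s) \<in> ideal_span S"
    if "i \<le> e" for i
  proof (rule form_reduce[OF S x top \<open>s \<le> e * \<delta>\<close>])
    have "homogeneous (i * \<delta> + (e - i) * (\<delta> * 1)) (v ^ i * (x ^ \<delta>) ^ (e - i))"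
      by (intro homogeneous_mult homogeneous_power v x)
    then show "homogeneous (e * \<delta>) (v ^ i * (x ^ \<delta>) ^ (e - i))"
      using that by (simp flip: distrib_right)
  qed
  then obtain w where w: "\<And>i. i \<le> e \<Longrightarrow> homogeneous s (w i)"
    "\<And>i. i \<le> e \<Longrightarrow> v ^ i * (x ^ \<delta>) ^ (e - i) - w i * x ^ (e * \<delta> - s) \<in> ideal_span S"
    by metis
  have "finite B" "card B \<le> e"
    by (simp_all add: B_def e_def finite_mdeg)
  moreover have "Poly_Mapping.keys (w i) \<subseteq> B" if "i \<le> e" for i
    using w(1)[OF that] by (auto simp: homogeneous_def B_def)
  ultimately obtain c where c: "\<exists>i\<le>e. c i \<noteq> 0" "(\<Sum>i\<le>e. Const (c i) * w i) = 0"
    by (rule linear_dependence)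
  define p where "p = (\<Sum>i\<le>e. monom (c i) i)"
  have coeff_p: "coeff p i = (if i \<le> e then c i else 0)" for i
    by (simp add: p_def coeff_sum if_distrib cong: if_cong)
  have "p \<noteq> 0" using c(1) coeff_p by (metis coeff_0)
  moreover have "degree p \<le> e" by (rule degree_le) (simp add: coeff_p)
  ultimately obtain L where L: "finite L"
    "\<forall>S. homog_eval p v (x ^ \<delta>) e \<in> ideal_span S \<longrightarrow>
       (\<forall>l\<in>L. in_radical (x ^ \<delta>) (insert (v - Const l * x ^ \<delta>) S)) \<longrightarrow> in_radical (x ^ \<delta>) S"
    using in_radical_if_linear_factors[of p e v "x ^ \<delta>"] by auto
  have "homog_eval p v (x ^ \<delta>) e
      = (\<Sum>i\<le>e. Const (c i) * (v ^ i * (x ^ \<delta>) ^ (e - i) - w i * x ^ (e * \<delta> - s)))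
        + (\<Sum>i\<le>e. Const (c i) * w i) * x ^ (e * \<delta> - s)"
    unfolding homog_eval_def sum_distrib_right sum.distrib[symmetric]
    by (intro sum.cong refl) (simp add: coeff_p algebra_simps)
  also have "\<dots> = (\<Sum>i\<le>e. Const (c i) * (v ^ i * (x ^ \<delta>) ^ (e - i) - w i * x ^ (e * \<delta> - s)))"
    by (simp only: c(2) mult_zero_left add_0_right)
  also have "\<dots> \<in> ideal_span S"
    by (intro ideal.span_sum mult_left_mem w(2)) simp
  finally have "homog_eval p v (x ^ \<delta>) e \<in> ideal_span S" .
  then have "homog_eval p v (x ^ \<delta>) e \<in> ideal_span S'" if "S \<subseteq> S'" for S'
    using that by (rule mem_mono)
  then have "in_radical x S'" 
    if "S \<subseteq> S'" "\<And>l. l \<in> L \<Longrightarrow> in_radical x (insert (v - Const l * x ^ \<delta>) S')" for S'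
    using L(2) that \<open>\<delta> > 0\<close> by (simp add: in_radical_power_iff)
  with L(1) show thesis by (rule that)
qed

text \<open>
  Two forms \<open>a, b\<close> of equal degree can be merged into a single combination \<open>a + t b\<close>. At a point where
  \<open>a\<close> and \<open>b\<close> take the values \<open>l\<close> and \<open>m\<close> relative to \<open>x\<^sup>\<delta>\<close>, the combination takes the value
  \<open>l + t m\<close>. By \<open>finite_eigenvalues\<close> finitely many pairs \<open>(l, m)\<close> are to be considered, so some \<open>t\<close>
  makes this value nonzero for all pairs other than \<open>(0, 0)\<close>. The remaining pair is the case covered
  by the hypothesis on \<open>a\<close> and \<open>b\<close>.
\<close>

lemma in_radical_linear_combination:
  fixes x a b :: "'n::finite cpoly"
  assumes S: "S \<subseteq> forms" and x: "homogeneous 1 x"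
    and top: "all_forms_above s (insert x S)"
    and a: "homogeneous \<delta> a" and b: "homogeneous \<delta> b" and "\<delta> > 0"
    and ab: "in_radical x (insert a (insert b S))"
  shows "\<exists>t. in_radical x (insert (a + Const t * b) S)"
proof -
  obtain L where L: "finite L" "\<And>S'. S \<subseteq> S' \<Longrightarrow> 
      (\<And>l. l \<in> L \<Longrightarrow> in_radical x (insert (a - Const l * x ^ \<delta>) S')) \<Longrightarrow> in_radical x S'"
    by (rule finite_eigenvalues[OF S x top a \<open>\<delta> > 0\<close>]) auto
  obtain M where M: "finite M" "\<And>S'. S \<subseteq> S' \<Longrightarrow> 
      (\<And>m. m \<in> M \<Longrightarrow> in_radical x (insert (b - Const m * x ^ \<delta>) S')) \<Longrightarrow> in_radical x S'"
    by (rule finite_eigenvalues[OF S x top b \<open>\<delta> > 0\<close>]) auto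
  \<comment> \<open>Division by \<open>m = 0\<close> excludes only the value \<open>0\<close> of \<open>t\<close>, which does no harm.\<close>
  have "finite ((\<lambda>(l, m). - l / m) ` (L \<times> M))" using L(1) M(1) by simp
  then obtain t where t: "t \<notin> (\<lambda>(l, m). - l / m) ` (L \<times> M)"
    using ex_new_if_finite[OF infinite_UNIV_char_0] by blast
  have nz: "l + t * m \<noteq> 0" if "l \<in> L" "m \<in> M" "l \<noteq> 0 \<or> m \<noteq> 0" for l m
  proof
    assume *: "l + t * m = 0"
    then have "m \<noteq> 0" using that(3) by auto
    then have "t = - l / m" using * by (simp add: field_simps eq_neg_iff_add_eq_0)
    then show False using t that by force
  qed
  let ?g = "a + Const t * b"
  have "in_radical x (insert ?g S)"
  proof (rule L(2))
    fix l assume "l \<in> L"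
    show "in_radical x (insert (a - Const l * x ^ \<delta>) (insert ?g S))"
    proof (rule M(2))
      fix m assume "m \<in> M"
      let ?U = "insert (b - Const m * x ^ \<delta>) (insert (a - Const l * x ^ \<delta>) (insert ?g S))"
      show "in_radical x ?U"
      proof (cases "l = 0 \<and> m = 0")
        case True
        then show ?thesis
          using ab by (elim in_radical_mono) (auto intro!: ideal.span_mono)
      next
        case False
        then have nz': "l + t * m \<noteq> 0" using nz \<open>l \<in> L\<close> \<open>m \<in> M\<close> by blast
        have "Const (l + t * m) * x ^ \<delta>
            = ?g - (a - Const l * x ^ \<delta>) - Const t * (b - Const m * x ^ \<delta>)"
          by (simp add: Const_add Const_mult algebra_simps)
        also have "\<dots> \<in> ideal_span ?U"
          by (intro ideal.span_diff mult_left_mem ideal.span_base) auto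
        finally have "Const (1 / (l + t * m)) * (Const (l + t * m) * x ^ \<delta>) \<in> ideal_span ?U"
          by (rule mult_left_mem)
        then have "x ^ \<delta> \<in> ideal_span ?U"
          using nz' by (simp add: mult.assoc[symmetric] flip: Const_mult)
        then show ?thesis by (auto simp: in_radical_def)
      qed
    qed auto
  qed auto
  then show ?thesis ..
qed

text \<open>
  A power of \<open>x\<close> in the ideal of \<open>S\<close> and \<open>V\<close> involves finitely many elements of \<open>V\<close> only. These are merged
  one after another by \<open>in_radical_linear_combination\<close>.
\<close>

lemma exists_parameter:
  fixes x :: "'n::finite cpoly"
  assumes S: "S \<subseteq> forms" and x: "homogeneous 1 x"
    and top: "all_forms_above s (insert x S)"
    and V: "V \<subseteq> {v. homogeneous \<delta> v}" "\<delta> > 0" "0 \<in> V"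
    and lin: "\<And>a b t. a \<in> V \<Longrightarrow> b \<in> V \<Longrightarrow> a + Const t * b \<in> V"
    and rad: "in_radical x (S \<union> V)"
  shows "\<exists>f\<in>V. in_radical x (insert f S)"
proof -
  \<comment> \<open>The set \<open>S'\<close> varies because the elements of \<open>T\<close> that wait to be merged are moved to it.\<close>
  have collapse: "\<exists>f\<in>V. in_radical x (insert f S')"
    if "finite T" "T \<subseteq> V" "S \<subseteq> S'" "S' \<subseteq> forms" "in_radical x (S' \<union> T)" for T S'
    using that
  proof (induction T arbitrary: S' rule: finite_induct)
    case empty
    then have "in_radical x S'" by simp
    then have "in_radical x (insert 0 S')"
      by (rule in_radical_mono) (intro ideal.span_mono, auto)
    then show ?case using V(3) by blast
  next
    case (insert b T)
    have b: "b \<in> V" "homogeneous \<delta> b" using insert.prems V by auto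
    have "\<exists>f\<in>V. in_radical x (insert f (insert b S'))"
      using insert.prems b by (intro insert.IH) (auto intro: formsI simp: insert_commute)
    then obtain f where f: "f \<in> V" "in_radical x (insert f (insert b S'))" by blast
    have "insert x S \<subseteq> insert x S'" using insert.prems(2) by auto
    then have top': "all_forms_above s (insert x S')"
      using top mem_mono unfolding all_forms_above_def by blast
    have "homogeneous \<delta> f" using f(1) V by auto
    from in_radical_linear_combination[OF insert.prems(3) x top' this b(2) V(2) f(2)]
    obtain t where "in_radical x (insert (f + Const t * b) S')" by auto
    then show ?case using lin f(1) b(1) by blast
  qed
  obtain N where "x ^ N \<in> ideal_span (S \<union> V)" using rad by (auto simp: in_radical_def)
  then obtain T where T: "finite T" "T \<subseteq> S \<union> V" "x ^ N \<in> ideal_span T"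
    unfolding ideal.span_explicit by blast
  have "x ^ N \<in> ideal_span (S \<union> (T \<inter> V))"
    by (rule mem_mono[OF T(3)]) (use T(2) in auto)
  then have "in_radical x (S \<union> (T \<inter> V))" by (auto simp: in_radical_def)
  then show ?thesis using T(1) S by (intro collapse[of "T \<inter> V"]) auto
qed

section \<open>Exchanging variables for parameters\<close>

text \<open>Modulo \<open>S\<close>, some power of \<open>x\<close> is a multiple of \<open>f\<close>, and that power is regular.\<close>

lemma regular_mod_parameter:
  assumes x: "regular_mod S x" and rad: "in_radical x (insert f S)"
  shows "regular_mod S f"
  unfolding regular_mod_def
proof (intro allI impI)
  fix y assume y: "f * y \<in> ideal_span S"
  obtain N r where r: "x ^ N - r * f \<in> ideal_span S"
    using rad by (auto simp: in_radical_def mem_insert_iff)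
  have "x ^ N * y = (x ^ N - r * f) * y + r * (f * y)"
    by (simp add: algebra_simps)
  also have "\<dots> \<in> ideal_span S"
    by (intro ideal.span_add mult_right_mem[OF r] mult_left_mem[OF y])
  finally show "y \<in> ideal_span S"
    by (rule regular_modD[OF regular_mod_power[OF x]])
qed

text \<open>
  Let \<open>A\<close> be the quotient ring by \<open>S\<close>. In large degrees \<open>A\<close> is covered by the multiples of \<open>f\<close>, as some
  power of \<open>x\<close> is such a multiple. This descends from degree \<open>k + 1\<close> to degree \<open>k\<close>: for \<open>u\<close> of degree
  \<open>k\<close> write \<open>x u = r f\<close> with \<open>r\<close> of degree \<open>k + 1 - \<delta>\<close>. While this degree is above \<open>s\<close>, \<open>r\<close> is
  divisible by \<open>x\<close>, and cancelling \<open>x\<close> exhibits \<open>u\<close> as a multiple of \<open>f\<close>.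
\<close>

lemma top_degree_parameter:
  fixes x f :: "'n::finite cpoly"
  assumes S: "S \<subseteq> forms" and x: "homogeneous 1 x" "regular_mod S x"
    and top: "all_forms_above s (insert x S)"
    and f: "homogeneous \<delta> f" and rad: "in_radical x (insert f S)"
    and k: "k \<ge> s + \<delta>" and u: "homogeneous k u"
  shows "u \<in> ideal_span (insert f S)"
proof -
  obtain N where N: "x ^ N \<in> ideal_span (insert f S)"
    using rad by (auto simp: in_radical_def)
  \<comment> \<open>Downward induction on the degree, where \<open>j\<close> bounds the distance to \<open>s + N\<close>.\<close>
  have "u \<in> ideal_span (insert f S)" if "s + N \<le> k + j" "k \<ge> s + \<delta>" "homogeneous k u" for j k u
    using that
  proof (induction j arbitrary: k u)
    case 0
    then obtain r where "u - r * x ^ (k - s) \<in> ideal_span S"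
      using form_reduce[OF S x(1) top, of k u] by auto
    then have "u - r * x ^ (k - s) \<in> ideal_span (insert f S)"
      by (rule mem_mono) auto
    moreover have "r * x ^ (k - s) = r * x ^ (k - s - N) * x ^ N"
      using 0 by (simp add: mult.assoc flip: power_add)
    then have "r * x ^ (k - s) \<in> ideal_span (insert f S)"
      using mult_left_mem[OF N] by simp
    ultimately have "(u - r * x ^ (k - s)) + r * x ^ (k - s) \<in> ideal_span (insert f S)"
      by (rule ideal.span_add)
    then show ?case by simp
  next
    case (Suc j)
    have xu: "homogeneous (Suc k) (x * u)"
      using homogeneous_mult[OF x(1) Suc.prems(3)] by simp
    have "x * u \<in> ideal_span (insert f S)"
      using Suc.prems xu by (intro Suc.IH[of "Suc k"]) auto
    from form_mem_insert[OF S f xu this]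
    consider "x * u \<in> ideal_span S" 
      | r where "homogeneous (Suc k - \<delta>) r" "x * u - r * f \<in> ideal_span S" by auto
    then show ?case
    proof cases
      case 1
      then have "u \<in> ideal_span S" by (rule regular_modD[OF x(2)])
      then show ?thesis by (rule mem_mono) auto
    next
      case 2
      have "Suc k - \<delta> > s" using Suc.prems by simp
      then obtain q where q: "r - q * x \<in> ideal_span S"
        using all_forms_aboveD[OF top _ 2(1)] by (auto simp: mem_insert_iff)
      have "x * (u - q * f) = (x * u - r * f) + (r - q * x) * f"
        by (simp add: algebra_simps)
      also have "\<dots> \<in> ideal_span S"
        by (intro ideal.span_add 2 mult_right_mem q)
      finally have "u - q * f \<in> ideal_span S"
        by (rule regular_modD[OF x(2)])
      then show ?thesis by (auto simp: mem_insert_iff)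
    qed
  qed
  from this[of k N u] show ?thesis using k u by simp
qed

text \<open>
  Here \<open>f\<close> takes the place of \<open>x r\<close> at the end of the regular sequence \<open>x 0, \<dots>, x r\<close> modulo \<open>F\<close>, and is
  then moved to the front. Moving it past \<open>x i\<close> uses both halves of the exchange law:
  \<open>regular_mod_descend\<close> keeps \<open>f\<close> regular modulo ever fewer variables, and \<open>regular_mod_insert\<close> keeps
  \<open>x i\<close> regular modulo \<open>f\<close>.
\<close>

lemma regular_sequence_replace:
  fixes x :: "nat \<Rightarrow> 'n::finite cpoly"
  assumes x: "\<And>i. homogeneous 1 (x i)" and F: "F \<subseteq> forms" and f: "homogeneous \<delta> f"
    and reg: "\<And>i. i \<le> r \<Longrightarrow> regular_mod (x ` {..<i} \<union> F) (x i)"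
    and f_reg: "regular_mod (x ` {..<r} \<union> F) f"
    and i: "i < r"
  shows "regular_mod (x ` {..<i} \<union> insert f F) (x i)"
proof -
  have forms: "x ` {..<i} \<union> F \<subseteq> forms" for i using x F formsI by auto
  have Suc: "x ` {..<Suc i} \<union> F = insert (x i) (x ` {..<i} \<union> F)" for i
    by (auto simp: lessThan_Suc)
  have "regular_mod (x ` {..<i} \<union> F) f" if "i \<le> r" for i
    using that
  proof (induction i rule: inc_induct)
    case base
    show ?case by (rule f_reg)
  next
    case (step i)
    then show ?case
      using regular_mod_descend[OF forms x _ f reg[of i]] by (simp add: Suc)
  qed
  from this[of "Suc i"] have "regular_mod (insert (x i) (x ` {..<i} \<union> F)) f"
    using i by (simp add: Suc)
  with reg[of i] have "regular_mod (insert f (x ` {..<i} \<union> F)) (x i)"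
    using i by (simp add: regular_mod_insert)
  then show ?thesis by simp
qed

text \<open>
  The complete intersection bound. The induction on the number \<open>j\<close> of exchanged variables carries along
  that the remaining variables form a regular sequence modulo the set \<open>F\<close> of chosen forms, and that
  together with \<open>F\<close> they generate all forms of degree above \<open>j(\<delta> - 1)\<close>. At \<open>j = 0\<close> these are the
  properties of the variables themselves, and at \<open>j = n\<close> no variable is left.
\<close>

theorem forms_mem_if_primary:
  fixes V :: "'n::finite cpoly set"
  assumes V: "V \<subseteq> {v. homogeneous \<delta> v}" "\<delta> > 0" "0 \<in> V"
    and lin: "\<And>a b t. a \<in> V \<Longrightarrow> b \<in> V \<Longrightarrow> a + Const t * b \<in> V"
    and rad: "\<And>i. in_radical (Var i) V"
    and k: "k > CARD('n) * (\<delta> - 1)" and u: "homogeneous k u"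
  shows "u \<in> ideal_span V"
proof -
  define n where "n = CARD('n)"
  obtain e :: "nat \<Rightarrow> 'n" where e: "bij_betw e {..<n} UNIV"
    using ex_bij_betw_nat_finite[of "UNIV :: 'n set"] by (auto simp: n_def atLeast0LessThan)
  define x where "x i = Var (e i)" for i
  have x: "homogeneous 1 (x i)" for i unfolding x_def by (rule homogeneous_Var)
  have "\<exists>F\<subseteq>V. (\<forall>i<n - j. regular_mod (x ` {..<i} \<union> F) (x i)) \<and>
      all_forms_above (j * (\<delta> - 1)) (x ` {..<n - j} \<union> F)"
    if "j \<le> n" for j
    using that
  proof (induction j)
    case 0
    have "regular_mod (x ` {..<i}) (x i)" if "i < n" for i
    proof -
      have "e i \<notin> e ` {..<i}"
        using inj_onD[OF bij_betw_imp_inj_on[OF e], of i] that by fastforce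
      from regular_mod_Vars[OF this] show ?thesis
        by (simp add: x_def image_image)
    qed
    moreover have "x ` {..<n} = range Var"
      using e unfolding bij_betw_def x_def by (metis image_image)
    ultimately show ?case
      using form_mem_all_Vars by (intro exI[of _ "{}"]) (auto simp: all_forms_above_def)
  next
    case (Suc j)
    define r where "r = n - Suc j"
    have r: "n - j = Suc r" using Suc.prems by (simp add: r_def)
    obtain F where F: "F \<subseteq> V" "\<And>i. i \<le> r \<Longrightarrow> regular_mod (x ` {..<i} \<union> F) (x i)"
      "all_forms_above (j * (\<delta> - 1)) (x ` {..<Suc r} \<union> F)"
      using Suc r by (auto simp: less_Suc_eq_le)
    define S where "S = x ` {..<r} \<union> F"
    have F_forms: "F \<subseteq> forms" using F(1) V(1) by (auto simp: forms_def)
    then have S: "S \<subseteq> forms" using x formsI by (auto simp: S_def)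
    have top: "all_forms_above (j * (\<delta> - 1)) (insert (x r) S)"
      using F(3) by (simp add: S_def lessThan_Suc)
    have "in_radical (x r) (S \<union> V)"
      unfolding x_def by (rule in_radical_mono[OF rad ideal.span_mono]) auto
    from exists_parameter[OF S x top V lin this]
    obtain f where f: "f \<in> V" "in_radical (x r) (insert f S)" by blast
    have fh: "homogeneous \<delta> f" using f(1) V(1) by auto
    have xr: "regular_mod S (x r)" using F(2)[of r] by (simp add: S_def)
    have "regular_mod (x ` {..<i} \<union> insert f F) (x i)" if "i < r" for i
      using regular_mod_parameter[OF xr f(2)] that
      by (intro regular_sequence_replace[OF x F_forms fh F(2)]) (auto simp: S_def)
    moreover have "all_forms_above (Suc j * (\<delta> - 1)) (x ` {..<r} \<union> insert f F)"
      unfolding all_forms_above_def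
    proof (intro allI impI)
      fix k and u :: "'n cpoly"
      assume "Suc j * (\<delta> - 1) < k" and u: "homogeneous k u"
      then have "k \<ge> j * (\<delta> - 1) + \<delta>" using V(2) by simp
      from top_degree_parameter[OF S x xr top fh f(2) this u]
      show "u \<in> ideal_span (x ` {..<r} \<union> insert f F)" by (simp add: S_def)
    qed
    ultimately show ?case
      using F(1) f(1) by (intro exI[of _ "insert f F"]) (auto simp: r_def)
  qed
  from this[of n] obtain F where "F \<subseteq> V" "u \<in> ideal_span F"
    using k u by (auto simp: n_def all_forms_above_def)
  then show ?thesis by (metis mem_mono)
qed

section \<open>Macaulay duality for the apolar ideal\<close>

definition coeff_functional :: "(('n \<Rightarrow>\<^sub>0 nat) \<Rightarrow> complex) \<Rightarrow> 'n cpoly \<Rightarrow> complex" where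
  "coeff_functional g p = (\<Sum>a\<in>Poly_Mapping.keys p. Poly_Mapping.lookup p a * g a)"

lemma coeff_functional_superset:
  assumes "finite A" "Poly_Mapping.keys p \<subseteq> A"
  shows "coeff_functional g p = (\<Sum>a\<in>A. Poly_Mapping.lookup p a * g a)"
  unfolding coeff_functional_def
  by (rule sum.mono_neutral_left) (use assms in \<open>auto simp: in_keys_iff\<close>)

lemma coeff_functional_0 [simp]: "coeff_functional g 0 = 0"
  by (simp add: coeff_functional_def)

lemma coeff_functional_add: "coeff_functional g (p + q) = coeff_functional g p + coeff_functional g q"
proof -
  let ?A = "Poly_Mapping.keys p \<union> Poly_Mapping.keys q"
  have "coeff_functional g h = (\<Sum>a\<in>?A. Poly_Mapping.lookup h a * g a)"
    if "Poly_Mapping.keys h \<subseteq> ?A" for h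
    using that by (intro coeff_functional_superset) auto
  from this[of p] this[of q] this[of "p + q"] show ?thesis
    using Poly_Mapping.keys_add[of p q] by (simp add: lookup_add algebra_simps sum.distrib)
qed

lemma coeff_functional_sum: "coeff_functional g (sum f A) = (\<Sum>a\<in>A. coeff_functional g (f a))"
  by (induction A rule: infinite_finite_induct) (simp_all add: coeff_functional_add)

lemma coeff_functional_single [simp]: "coeff_functional g (Poly_Mapping.single m c) = c * g m"
  by (simp add: coeff_functional_def)

lemma coeff_functional_single_mult:
  "coeff_functional g (Poly_Mapping.single m c * p) =
     c * (\<Sum>a\<in>Poly_Mapping.keys p. Poly_Mapping.lookup p a * g (m + a))"
proof -
  have "Poly_Mapping.single m c * p = (\<Sum>a\<in>Poly_Mapping.keys p.
      Poly_Mapping.single m c * Poly_Mapping.single a (Poly_Mapping.lookup p a))"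
    by (simp only: sum_single_keys flip: sum_distrib_left)
  then show ?thesis
    by (simp add: mult_single coeff_functional_sum sum_distrib_left mult.assoc)
qed

text \<open>
  The coefficients of \<open>F\<close> with respect to the divided power monomials \<open>x\<^sup>m / m!\<close>. In these coordinates
  partial differentiation is a plain shift of exponents, without numerical factors.
\<close>

definition dp_coeff :: "'n::finite cpoly \<Rightarrow> ('n \<Rightarrow>\<^sub>0 nat) \<Rightarrow> complex" where
  "dp_coeff F m = (\<Prod>i\<in>UNIV. fact (Poly_Mapping.lookup m i)) * Poly_Mapping.lookup F m"

lemma dp_coeff_eq_0_iff: "dp_coeff F m = 0 \<longleftrightarrow> Poly_Mapping.lookup F m = 0"
  by (simp add: dp_coeff_def)

lemma dp_coeff_pdiff: "dp_coeff (pdiff i F) m = dp_coeff F (m + Poly_Mapping.single i 1)"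
proof -
  have "(\<Prod>j\<in>UNIV. fact (Poly_Mapping.lookup (m + Poly_Mapping.single i 1) j))
      = (\<Prod>j\<in>UNIV. (if j = i then of_nat (Poly_Mapping.lookup m i + 1) else 1) *
          (fact (Poly_Mapping.lookup m j) :: complex))"
    by (intro prod.cong refl) (auto simp: lookup_add lookup_single when_def)
  also have "\<dots> = of_nat (Poly_Mapping.lookup m i + 1) * (\<Prod>j\<in>UNIV. fact (Poly_Mapping.lookup m j))"
    by (simp add: prod.distrib)
  finally show ?thesis
    by (simp only: dp_coeff_def lookup_pdiff ac_simps)
qed

lemma dp_coeff_pdiff_power:
  "dp_coeff ((pdiff i ^^ k) F) m = dp_coeff F (m + Poly_Mapping.single i k)"
  by (induction k arbitrary: m) (simp_all add: dp_coeff_pdiff add.assoc flip: single_add)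

lemma dp_coeff_pdiff_monom: "dp_coeff (pdiff_monom a F) m = dp_coeff F (m + a)"
proof -
  let ?f = "\<lambda>i. pdiff i ^^ Poly_Mapping.lookup a i"
  interpret comp_fun_commute ?f by (rule pdiff_monom_comp_fun_commute)
  have "dp_coeff (Finite_Set.fold ?f F A) m
      = dp_coeff F (m + (\<Sum>i\<in>A. Poly_Mapping.single i (Poly_Mapping.lookup a i)))" for A
    using finite[of A]
    by (induction A arbitrary: m rule: finite_induct)
       (simp_all add: dp_coeff_pdiff_power add.assoc)
  moreover have "(\<Sum>i\<in>UNIV. Poly_Mapping.single i (Poly_Mapping.lookup a i)) = a"
    by (rule poly_mapping_eqI) (simp add: lookup_sum lookup_single when_def)
  ultimately show ?thesis by (simp add: pdiff_monom_def)
qed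

lemma dp_coeff_diff_act:
  "dp_coeff (diff_act \<Theta> F) m = coeff_functional (dp_coeff F) (Poly_Mapping.single m 1 * \<Theta>)"
proof -
  have "dp_coeff (diff_act \<Theta> F) m =
      (\<Sum>a\<in>Poly_Mapping.keys \<Theta>. Poly_Mapping.lookup \<Theta> a * dp_coeff (pdiff_monom a F) m)"
    unfolding dp_coeff_def diff_act_def lookup_sum lookup_Const_mult sum_distrib_left
    by (intro sum.cong refl) (simp add: ac_simps)
  then show ?thesis
    by (simp add: dp_coeff_pdiff_monom coeff_functional_single_mult)
qed

text \<open>
  The divided power coefficient of \<open>\<Theta> \<circ> F\<close> at \<open>m\<close> is the value of the functional of \<open>F\<close> at
  \<open>\<alpha>\<^sup>m \<Theta>\<close>. So \<open>\<Theta>\<close> annihilates \<open>F\<close> iff the functional vanishes on the principal ideal of \<open>\<Theta>\<close>, which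
  makes the ideal property and the grading of the apolar ideal evident.
\<close>

lemma apolar_iff: "\<Theta> \<in> apolar_ideal F \<longleftrightarrow> (\<forall>Q. coeff_functional (dp_coeff F) (Q * \<Theta>) = 0)"
proof
  assume "\<Theta> \<in> apolar_ideal F"
  then have 0: "coeff_functional (dp_coeff F) (Poly_Mapping.single m 1 * \<Theta>) = 0" for m
    by (simp add: apolar_ideal_def dp_coeff_def flip: dp_coeff_diff_act)
  show "\<forall>Q. coeff_functional (dp_coeff F) (Q * \<Theta>) = 0"
  proof
    fix Q
    have "Q * \<Theta> = (\<Sum>m\<in>Poly_Mapping.keys Q.
        Poly_Mapping.single m (Poly_Mapping.lookup Q m) * \<Theta>)"
      by (simp only: sum_single_keys flip: sum_distrib_right)
    then show "coeff_functional (dp_coeff F) (Q * \<Theta>) = 0"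
      using 0 by (simp add: coeff_functional_sum coeff_functional_single_mult)
  qed
next
  assume "\<forall>Q. coeff_functional (dp_coeff F) (Q * \<Theta>) = 0"
  then have "dp_coeff (diff_act \<Theta> F) m = 0" for m
    by (simp add: dp_coeff_diff_act)
  then show "\<Theta> \<in> apolar_ideal F"
    unfolding apolar_ideal_def dp_coeff_eq_0_iff by (auto intro: poly_mapping_eqI)
qed

lemma subspace_apolar_ideal: "ideal.subspace (apolar_ideal F)"
  unfolding ideal.subspace_def
  by (auto simp: apolar_iff distrib_left coeff_functional_add simp flip: mult.assoc)

lemma coeff_functional_hcomp:
  assumes "homogeneous d F"
  shows "coeff_functional (dp_coeff F) p = coeff_functional (dp_coeff F) (hcomp d p)"
proof -
  have "coeff_functional (dp_coeff F) (hcomp d p)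
      = (\<Sum>a\<in>Poly_Mapping.keys p. Poly_Mapping.lookup (hcomp d p) a * dp_coeff F a)"
    by (rule coeff_functional_superset) (auto simp: in_keys_iff lookup_hcomp split: if_splits)
  also have "\<dots> = (\<Sum>a\<in>Poly_Mapping.keys p. Poly_Mapping.lookup p a * dp_coeff F a)"
    using assms by (intro sum.cong refl)
      (auto simp: lookup_hcomp dp_coeff_eq_0_iff homogeneous_def in_keys_iff)
  finally show ?thesis by (simp add: coeff_functional_def)
qed

lemma hcomp_apolar:
  assumes F: "homogeneous d F" and "\<Theta> \<in> apolar_ideal F"
  shows "hcomp k \<Theta> \<in> apolar_ideal F"
  unfolding apolar_iff
proof
  fix Q
  have "hcomp d (Q * hcomp k \<Theta>) = (if k \<le> d then hcomp d (hcomp (d - k) Q * \<Theta>) else 0)"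
    using hcomp_mult[OF homogeneous_hcomp[of k \<Theta>], of d Q]
      hcomp_mult[OF homogeneous_hcomp[of "d - k" Q], of d \<Theta>]
    by (simp add: mult.commute)
  then show "coeff_functional (dp_coeff F) (Q * hcomp k \<Theta>) = 0"
    using assms(2) by (subst coeff_functional_hcomp[OF F])
      (auto simp: apolar_iff simp flip: coeff_functional_hcomp[OF F])
qed

lemma apolar_if_degree_gt:
  assumes "homogeneous d F" and "homogeneous k \<Theta>" and "k > d"
  shows "\<Theta> \<in> apolar_ideal F"
  unfolding apolar_iff
  using assms(3) by (auto simp: coeff_functional_hcomp[OF assms(1)] hcomp_mult[OF assms(2)])

lemma not_apolar_form:
  assumes "F \<noteq> 0" and "homogeneous d F"
  obtains \<Theta> where "homogeneous d \<Theta>" and "\<Theta> \<notin> apolar_ideal F"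
proof -
  obtain m where m: "m \<in> Poly_Mapping.keys F"
    using assms(1) by (metis equals0I keys_eq_empty)
  have "coeff_functional (dp_coeff F) (1 * Poly_Mapping.single m 1) \<noteq> 0"
    using m by (simp add: dp_coeff_eq_0_iff in_keys_iff)
  then have "Poly_Mapping.single m 1 \<notin> apolar_ideal F" unfolding apolar_iff by blast
  moreover have "homogeneous d (Poly_Mapping.single m (1 :: complex))"
    using m assms(2) by (intro homogeneous_single) (simp add: homogeneous_def)
  ultimately show thesis by (rule that[rotated])
qed

section \<open>Degrees of minimal generators\<close>

text \<open>
  An element of \<open>\<mm> I\<close> is a sum of products of variables with elements of the homogeneous ideal \<open>I\<close>, so
  its part of degree \<open>k + 1\<close> only involves the part of degree \<open>k\<close> of \<open>I\<close>.
\<close>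

lemma hcomp_irrelevant_mult:
  assumes sub: "ideal.subspace I" and hom: "\<And>k p. p \<in> I \<Longrightarrow> hcomp k p \<in> I"
    and p: "p \<in> ideal_mult irrelevant_ideal I"
  shows "hcomp (Suc k) p \<in> ideal_span (I \<inter> {q. homogeneous k q})"
proof -
  have prod: "hcomp (Suc k) (a * b) \<in> ideal_span (I \<inter> {q. homogeneous k q})"
    if "a \<in> irrelevant_ideal" "b \<in> I" for a b
    using that(1) unfolding irrelevant_ideal_def
  proof (induction a rule: ideal.span_induct_alt)
    case base
    show ?case by (simp add: ideal.span_zero)
  next
    case (step c x y)
    then obtain i where x: "x = Var i" by auto
    have "hcomp k (c * b) \<in> I"
      by (intro hom ideal.subspace_scale sub \<open>b \<in> I\<close>)
    then have "hcomp k (c * b) \<in> ideal_span (I \<inter> {q. homogeneous k q})"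
      by (intro ideal.span_base) (simp add: homogeneous_hcomp)
    moreover have "hcomp (Suc k) ((c * x + y) * b) = hcomp k (c * b) * x + hcomp (Suc k) (y * b)"
      using hcomp_mult[OF homogeneous_Var[of i], of "Suc k" "c * b"]
      by (simp add: x distrib_left distrib_right hcomp_add ac_simps)
    ultimately show ?case
      using step(2) by (simp add: ideal.span_add mult_right_mem)
  qed
  show ?thesis
    using p unfolding ideal_mult_def
  proof (induction p rule: ideal.span_induct_alt)
    case base
    show ?case by (simp add: ideal.span_zero)
  next
    case (step c x y)
    then obtain a b where ab: "x = a * b" "a \<in> irrelevant_ideal" "b \<in> I" by auto
    have "c * x = a * (c * b)" by (simp add: ab(1) ac_simps)
    moreover have "hcomp (Suc k) (a * (c * b)) \<in> ideal_span (I \<inter> {q. homogeneous k q})"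
      by (intro prod ab ideal.subspace_scale sub)
    ultimately show ?case
      using step(2) by (simp add: hcomp_add ideal.span_add)
  qed
qed

text \<open>
  A graded form of Nakayama's lemma: without minimal generators in degree \<open>k + 1\<close>, the forms of degree
  \<open>k + 1\<close> in \<open>I\<close> are generated by those of degree \<open>k\<close>.
\<close>

lemma generated_in_degree:
  assumes sub: "ideal.subspace I" and hom: "\<And>k p. p \<in> I \<Longrightarrow> hcomp k p \<in> I"
    and no_gen: "\<And>k. k > \<delta> \<Longrightarrow> k \<notin> min_gen_degrees I"
    and k: "\<delta> \<le> k" and p: "p \<in> I" "homogeneous k p"
  shows "p \<in> ideal_span (I \<inter> {q. homogeneous \<delta> q})"
  using k p
proof (induction k arbitrary: p rule: dec_induct)
  case base
  then show ?case by (intro ideal.span_base) simp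
next
  case (step k)
  have "p \<in> ideal_mult irrelevant_ideal I"
    using no_gen[of "Suc k"] step by (auto simp: min_gen_degrees_def)
  from hcomp_irrelevant_mult[OF sub hom this, of k]
  have "p \<in> ideal_span (I \<inter> {q. homogeneous k q})"
    using step.prems(2) by (simp add: hcomp_homogeneous)
  also have "\<dots> \<subseteq> ideal_span (I \<inter> {q. homogeneous \<delta> q})"
    by (intro ideal.span_minimal ideal.subspace_span) (use step.IH in auto)
  finally show ?case .
qed

text \<open>
  Above degree \<open>d + 1\<close>, a form is a combination of variables with forms of degree above \<open>d\<close> as
  coefficients, and these coefficients are apolar to \<open>F\<close>. Hence the set of degrees is finite, and its
  maximum is an upper bound.
\<close>

lemma min_gen_degrees_apolar:
  assumes F: "homogeneous d F" and k: "k \<in> min_gen_degrees (apolar_ideal F)"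
  shows "k \<le> Suc d"
proof (rule ccontr)
  assume "\<not> k \<le> Suc d"
  then obtain l where l: "k = Suc l" "l > d" by (cases k) auto
  obtain \<Theta> where \<Theta>: "homogeneous k \<Theta>" "\<Theta> \<notin> ideal_mult irrelevant_ideal (apolar_ideal F)"
    using k by (auto simp: min_gen_degrees_def)
  have "\<Theta> \<in> ideal_span (range Var)"
    using form_mem_all_Vars[OF \<Theta>(1)] l by simp
  then have "hcomp k \<Theta> \<in> ideal_mult irrelevant_ideal (apolar_ideal F)"
  proof (induction \<Theta> rule: ideal.span_induct_alt)
    case base
    show ?case by (simp add: ideal_mult_def ideal.span_zero)
  next
    case (step c x y)
    then obtain i where x: "x = Var i" by auto
    have "hcomp k (c * x) = x * hcomp l c"
      using hcomp_mult[OF homogeneous_Var[of i], of k c] l by (simp add: x mult.commute)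
    moreover have "x \<in> irrelevant_ideal"
      using step(1) by (simp add: irrelevant_ideal_def ideal.span_base)
    moreover have "hcomp l c \<in> apolar_ideal F"
      using apolar_if_degree_gt[OF F homogeneous_hcomp] l by blast
    ultimately have "hcomp k (c * x) \<in> ideal_mult irrelevant_ideal (apolar_ideal F)"
      unfolding ideal_mult_def by (intro ideal.span_base) auto
    then show ?case
      using step(2) by (simp add: hcomp_add ideal_mult_def ideal.span_add)
  qed
  then show False using \<Theta> by (simp add: hcomp_homogeneous)
qed

theorem theorem1p9:
  fixes F :: "'n::finite cpoly" and d \<delta> :: nat
  assumes "F \<noteq> 0" and "homogeneous d F"
    and "\<delta> = Max (min_gen_degrees (apolar_ideal F))"
  shows "int d \<le> (int \<delta> - 1) * int CARD('n)"
proof -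
  let ?J = "apolar_ideal F"
  define V where "V = ?J \<inter> {p. homogeneous \<delta> p}"
  note sub = subspace_apolar_ideal[of F]
  have "min_gen_degrees ?J \<subseteq> {..Suc d}"
    using min_gen_degrees_apolar[OF assms(2)] by blast
  then have "finite (min_gen_degrees ?J)"
    by (rule finite_subset) simp
  then have no_gen: "k \<notin> min_gen_degrees ?J" if "k > \<delta>" for k
    using that unfolding assms(3) by (metis Max_ge not_le)
  have span_V: "ideal_span V \<subseteq> ?J"
    using sub by (intro ideal.span_minimal) (auto simp: V_def)
  obtain \<Theta> where \<Theta>: "homogeneous d \<Theta>" "\<Theta> \<notin> ?J"
    using not_apolar_form[OF assms(1,2)] by blast
  have rad: "in_radical (Var i) V" for i
  proof -
    define N where "N = Suc d + \<delta>"
    have N: "homogeneous N (Var i ^ N)"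
      using homogeneous_power[OF homogeneous_Var, of N i] by simp
    then have "Var i ^ N \<in> ?J"
      by (rule apolar_if_degree_gt[OF assms(2)]) (simp add: N_def)
    from generated_in_degree[OF sub hcomp_apolar[OF assms(2)] no_gen _ this N]
    have "Var i ^ N \<in> ideal_span V" by (simp add: V_def N_def)
    then show ?thesis by (auto simp: in_radical_def)
  qed
  \<comment> \<open>If \<open>\<delta>\<close> were \<open>0\<close>, then \<open>V\<close> would consist of constants. A nonzero constant would make \<open>?J\<close> the whole
    ring, and \<open>V = {0}\<close> contradicts that \<open>(V)\<close> contains powers of the variables.\<close>
  have "\<delta> > 0"
  proof (rule ccontr)
    assume "\<not> \<delta> > 0"
    have "p = 0" if "p \<in> V" for p
    proof (rule ccontr)
      assume "p \<noteq> 0"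
      obtain c where p: "p = Const c"
        using homogeneous_0_eq_Const[of p] \<open>p \<in> V\<close> \<open>\<not> \<delta> > 0\<close> by (auto simp: V_def)
      with \<open>p \<noteq> 0\<close> have "c \<noteq> 0" by auto
      have "Const (1 / c) * p \<in> ?J"
        using \<open>p \<in> V\<close> by (intro ideal.subspace_scale[OF sub]) (simp add: V_def)
      then have "1 \<in> ?J" using \<open>c \<noteq> 0\<close> by (simp add: p flip: Const_mult)
      from ideal.subspace_scale[OF sub this, of \<Theta>] show False using \<Theta>(2) by simp
    qed
    then have "ideal_span V \<subseteq> {0}" by (intro ideal.span_minimal) auto
    then obtain i :: 'n and N where "Var i ^ N = 0"
      using rad unfolding in_radical_def by blast
    moreover have "Var i ^ N = Poly_Mapping.single (Poly_Mapping.single i N) 1" for N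
      by (induction N) (simp_all add: Var_def mult_single flip: single_add)
    ultimately have "Poly_Mapping.single (Poly_Mapping.single i N) (1 :: complex) = 0" by simp
    then show False by (metis lookup_single_eq lookup_zero zero_neq_one)
  qed
  have "d \<le> CARD('n) * (\<delta> - 1)"
  proof (rule ccontr)
    assume "\<not> d \<le> CARD('n) * (\<delta> - 1)"
    have "\<Theta> \<in> ideal_span V"
    proof (rule forms_mem_if_primary[of V \<delta>])
      show "V \<subseteq> {v. homogeneous \<delta> v}" by (auto simp: V_def)
      show "0 \<in> V" using ideal.subspace_0[OF sub] by (simp add: V_def)
      show "a + Const t * b \<in> V" if "a \<in> V" "b \<in> V" for a b t
        using that homogeneous_mult[OF homogeneous_Const, of \<delta> b t]
        by (auto simp: V_def intro: homogeneous_add ideal.subspace_add[OF sub]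
            ideal.subspace_scale[OF sub])
    qed (use \<open>\<not> d \<le> _\<close> \<open>\<delta> > 0\<close> rad \<Theta>(1) in auto)
    then show False using span_V \<Theta>(2) by blast
  qed
  then have "int d \<le> int (CARD('n) * (\<delta> - 1))" by (simp only: of_nat_le_iff)
  also have "\<dots> = (int \<delta> - 1) * int CARD('n)"
    using \<open>\<delta> > 0\<close> by (simp add: of_nat_diff)
  finally show ?thesis .
qed

end
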